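(* Let $\Sigma=(\Gamma,sgn)$ be a simple signed graph with edge set $E=\{e_1,\dots,e_m\}$, and let $G=(\Sigma,\tau)$ be an oriented signed graph, regarded as a simple 2-uniform oriented hypergraph. Then $A_{(\Lambda(\Gamma),\tau_\Lambda)}=A_{G^*}$, where both matrices are $m\times m$ with rows and columns indexed by $e_1,\dots,e_m$.
   Context: A signed graph $\Sigma=(\Gamma,sgn)$ is a graph $\Gamma=(V,E)$ with a signature $sgn:E\to\{+1,-1\}$; simple means no loops or multiple edges. An orientation is $\tau:V\times E\to\{-1,0,+1\}$ with $\tau(v,e)\neq 0$ iff $v$ is incident to $e$, and $\tau(v,e)\tau(w,e)=-sgn(e)$ when $e$ joins $v$ and $w$; $(\Sigma,\tau)$ is an oriented signed graph. It is regarded as the oriented hypergraph with vertex set $V$, edge set $E$, incidences $(v,e)$ for $v$ an endpoint of $e$, and incidence orientation $\sigma(v,e)=\tau(v,e)$. For a simple oriented hypergraph $H$ (each vertex-edge pair incident at most once), vertices $v\ne w$ are adjacent with respect to edge $e$ if both are incident to $e$, with adjacency sign $sgn_e(v,w)=-\sigma(v,e)\sigma(w,e)$ ($0$ if not adjacent, and $sgn_e(v,v)=0$); the adjacency matrix is $A_H=[a_{ij}]$ with $a_{ij}=\sum_{e}sgn_e(v_i,v_j)$. The incidence dual $G^*$ has vertex set $E$, edge set $V$, incidences $(e,v)$ for each incidence $(v,e)$ of $G$, and orientation $\sigma^*(e,v)=\sigma(v,e)$. The line graph $\Lambda(\Gamma)$ has vertex set $E$, with an edge $e_{ij}e_{jk}$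 joining any two edges $e_{ij},e_{jk}$ of $\Gamma$ sharing a vertex $v_j$. Its orientation is $\tau_\Lambda(e_{ij},e_{ij}e_{jk})=\tau(v_j,e_{ij})$, making $(\Lambda(\Gamma),\tau_\Lambda)$ an oriented signed graph whose edge signs are $sgn_{\Lambda(\tau)}(e_{ij}e_{jk})=-\tau_\Lambda(e_{ij},e_{ij}e_{jk})\tau_\Lambda(e_{jk},e_{ij}e_{jk})$; its adjacency matrix is that of the corresponding oriented hypergraph. *)

theory Defs
  imports "Jordan_Normal_Form.Matrix"
begin

section \<open>Graphs and signed graphs\<close>

text \<open>
  An edge is an abstract object with a set of one or two endpoints: loops (one endpoint) and
  parallel edges are allowed in general and excluded by \<open>simple_graph\<close>.
\<close>

record ('v, 'e) ugraph =
  verts :: "'v set"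
  edges :: "'e set"
  ends :: "'e \<Rightarrow> 'v set"

definition graph :: "('v, 'e) ugraph \<Rightarrow> bool" where
  "graph \<Gamma> \<longleftrightarrow> finite (verts \<Gamma>) \<and> finite (edges \<Gamma>) \<and>
    (\<forall>e \<in> edges \<Gamma>. ends \<Gamma> e \<subseteq> verts \<Gamma> \<and> card (ends \<Gamma> e) \<in> {1, 2})"

definition simple_graph :: "('v, 'e) ugraph \<Rightarrow> bool" where
  "simple_graph \<Gamma> \<longleftrightarrow> graph \<Gamma> \<and>
    (\<forall>e \<in> edges \<Gamma>. card (ends \<Gamma> e) = 2) \<and> inj_on (ends \<Gamma>) (edges \<Gamma>)"

type_synonym ('v, 'e) signed_graph = "('v, 'e) ugraph \<times> ('e \<Rightarrow> int)"

fun is_signed_graph :: "('v, 'e) signed_graph \<Rightarrow> bool" where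
  "is_signed_graph (\<Gamma>, s) \<longleftrightarrow> graph \<Gamma> \<and> (\<forall>e \<in> edges \<Gamma>. s e \<in> {1, -1})"

fun simple_signed_graph :: "('v, 'e) signed_graph \<Rightarrow> bool" where
  "simple_signed_graph (\<Gamma>, s) \<longleftrightarrow> is_signed_graph (\<Gamma>, s) \<and> simple_graph \<Gamma>"

type_synonym ('v, 'e) oriented_signed_graph =
  "('v, 'e) signed_graph \<times> ('v \<Rightarrow> 'e \<Rightarrow> int)"

text \<open>The values of \<open>\<tau>\<close> outside \<open>verts \<Gamma> \<times> edges \<Gamma>\<close> are irrelevant.\<close>

fun is_oriented_signed_graph :: "('v, 'e) oriented_signed_graph \<Rightarrow> bool" where
  "is_oriented_signed_graph ((\<Gamma>, s), \<tau>) \<longleftrightarrow> is_signed_graph (\<Gamma>, s) \<and>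
    (\<forall>v \<in> verts \<Gamma>. \<forall>e \<in> edges \<Gamma>.
      \<tau> v e \<in> {-1, 0, 1} \<and> (\<tau> v e \<noteq> 0 \<longleftrightarrow> v \<in> ends \<Gamma> e)) \<and>
    (\<forall>e \<in> edges \<Gamma>. \<forall>v w. ends \<Gamma> e = {v, w} \<longrightarrow> \<tau> v e * \<tau> w e = - s e)"

section \<open>Simple oriented hypergraphs\<close>

text \<open>
  Since the incidences form a set of vertex-edge pairs, each vertex-edge pair is incident at most
  once.
\<close>

record ('v, 'e) ohypergraph =
  hverts :: "'v set"
  hedges :: "'e set"
  incs :: "('v \<times> 'e) set"
  hsign :: "'v \<Rightarrow> 'e \<Rightarrow> int"

definition simple_oriented_hypergraph :: "('v, 'e) ohypergraph \<Rightarrow> bool" where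
  "simple_oriented_hypergraph H \<longleftrightarrow> finite (hverts H) \<and> finite (hedges H) \<and>
    incs H \<subseteq> hverts H \<times> hedges H \<and> (\<forall>(v, e) \<in> incs H. hsign H v e \<in> {1, -1})"

definition uniform :: "nat \<Rightarrow> ('v, 'e) ohypergraph \<Rightarrow> bool" where
  "uniform k H \<longleftrightarrow> (\<forall>e \<in> hedges H. card {v. (v, e) \<in> incs H} = k)"

definition adj_sign :: "('v, 'e) ohypergraph \<Rightarrow> 'e \<Rightarrow> 'v \<Rightarrow> 'v \<Rightarrow> int" where
  "adj_sign H e v w =
    (if v \<noteq> w \<and> (v, e) \<in> incs H \<and> (w, e) \<in> incs H then - hsign H v e * hsign H w e else 0)"

text \<open>The list \<open>vs\<close> enumerates the vertices of \<open>H\<close> and fixes the order of rows and columns.\<close>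

definition adjacency_matrix :: "('v, 'e) ohypergraph \<Rightarrow> 'v list \<Rightarrow> int mat" where
  "adjacency_matrix H vs =
    mat (length vs) (length vs) (\<lambda>(i, j). \<Sum>e \<in> hedges H. adj_sign H e (vs ! i) (vs ! j))"

definition incidence_dual :: "('v, 'e) ohypergraph \<Rightarrow> ('e, 'v) ohypergraph" where
  "incidence_dual H =
    \<lparr>hverts = hedges H, hedges = hverts H, incs = (incs H)\<inverse>, hsign = (\<lambda>e v. hsign H v e)\<rparr>"

fun hypergraph_of :: "('v, 'e) oriented_signed_graph \<Rightarrow> ('v, 'e) ohypergraph" where
  "hypergraph_of ((\<Gamma>, s), \<tau>) =
    \<lparr>hverts = verts \<Gamma>, hedges = edges \<Gamma>,
     incs = {(v, e). v \<in> verts \<Gamma> \<and> e \<in> edges \<Gamma> \<and> v \<in> ends \<Gamma> e}, hsign = \<tau>\<rparr>"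

section \<open>Line graphs\<close>

text \<open>
  The edge joining \<open>e\<close> and \<open>f\<close> is represented by the unordered pair \<open>{e, f}\<close>. This is adequate
  for simple graphs, where distinct edges share at most one vertex.
\<close>

definition line_graph :: "('v, 'e) ugraph \<Rightarrow> ('e, 'e set) ugraph" where
  "line_graph \<Gamma> =
    \<lparr>verts = edges \<Gamma>,
     edges = {{e, f} |e f. e \<in> edges \<Gamma> \<and> f \<in> edges \<Gamma> \<and> e \<noteq> f \<and> ends \<Gamma> e \<inter> ends \<Gamma> f \<noteq> {}},
     ends = (\<lambda>p. p)\<rparr>"

definition common_vertex :: "('v, 'e) ugraph \<Rightarrow> 'e set \<Rightarrow> 'v" where
  "common_vertex \<Gamma> p = (THE v. \<forall>e \<in> p. v \<in> ends \<Gamma> e)"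

definition line_orientation ::
    "('v, 'e) ugraph \<Rightarrow> ('v \<Rightarrow> 'e \<Rightarrow> int) \<Rightarrow> 'e \<Rightarrow> 'e set \<Rightarrow> int" where
  "line_orientation \<Gamma> \<tau> e p = (if e \<in> p then \<tau> (common_vertex \<Gamma> p) e else 0)"

text \<open>For \<open>p = {e, f}\<close> with \<open>e \<noteq> f\<close> the product has the two factors belonging to \<open>e\<close> and \<open>f\<close>.\<close>

definition line_sign :: "('v, 'e) ugraph \<Rightarrow> ('v \<Rightarrow> 'e \<Rightarrow> int) \<Rightarrow> 'e set \<Rightarrow> int" where
  "line_sign \<Gamma> \<tau> p = - (\<Prod>e \<in> p. line_orientation \<Gamma> \<tau> e p)"

fun oriented_line_graph ::
    "('v, 'e) oriented_signed_graph \<Rightarrow> ('e, 'e set) oriented_signed_graph" where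
  "oriented_line_graph ((\<Gamma>, s), \<tau>) =
    ((line_graph \<Gamma>, line_sign \<Gamma> \<tau>), line_orientation \<Gamma> \<tau>)"

section \<open>Well-formedness of the constructions\<close>

lemma adjacency_matrix_carrier [simp]:
  "adjacency_matrix H vs \<in> carrier_mat (length vs) (length vs)"
  by (simp add: adjacency_matrix_def)

lemma simple_oriented_hypergraph_hypergraph_of:
  assumes "is_oriented_signed_graph ((\<Gamma>, s), \<tau>)"
  shows "simple_oriented_hypergraph (hypergraph_of ((\<Gamma>, s), \<tau>))"
  using assms by (fastforce simp: simple_oriented_hypergraph_def graph_def)

lemma uniform_hypergraph_of:
  assumes "simple_signed_graph (\<Gamma>, s)"
  shows "uniform 2 (hypergraph_of ((\<Gamma>, s), \<tau>))"
proof -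
  have "{v. (v, e) \<in> incs (hypergraph_of ((\<Gamma>, s), \<tau>))} = ends \<Gamma> e" if "e \<in> edges \<Gamma>" for e
    using assms that by (auto simp: graph_def)
  then show ?thesis
    using assms by (simp add: uniform_def simple_graph_def)
qed

lemma simple_oriented_hypergraph_incidence_dual:
  assumes "simple_oriented_hypergraph H"
  shows "simple_oriented_hypergraph (incidence_dual H)"
  using assms by (auto simp: simple_oriented_hypergraph_def incidence_dual_def)

lemma simple_graph_common_vertex_unique:
  assumes "simple_graph \<Gamma>" "e \<in> edges \<Gamma>" "f \<in> edges \<Gamma>" "e \<noteq> f"
    and "v \<in> ends \<Gamma> e" "v \<in> ends \<Gamma> f" "w \<in> ends \<Gamma> e" "w \<in> ends \<Gamma> f"
  shows "v = w"
proof (rule ccontr)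
  assume "v \<noteq> w"
  have *: "ends \<Gamma> g = {v, w}" if "g \<in> edges \<Gamma>" "v \<in> ends \<Gamma> g" "w \<in> ends \<Gamma> g" for g
  proof -
    have "card (ends \<Gamma> g) = 2"
      using assms(1) that by (simp add: simple_graph_def)
    then show ?thesis
      using that \<open>v \<noteq> w\<close> by (auto simp: card_2_iff)
  qed
  have "ends \<Gamma> e = ends \<Gamma> f"
    using *[OF assms(2,5,7)] *[OF assms(3,6,8)] by simp
  then show False
    using assms(1-4) by (auto simp: simple_graph_def dest: inj_onD)
qed

lemma common_vertex_eq:
  assumes "simple_graph \<Gamma>" "e \<in> edges \<Gamma>" "f \<in> edges \<Gamma>" "e \<noteq> f"
    and "v \<in> ends \<Gamma> e" "v \<in> ends \<Gamma> f"
  shows "common_vertex \<Gamma> {e, f} = v"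
  unfolding common_vertex_def
  by (rule the_equality) (use assms simple_graph_common_vertex_unique[OF assms(1-4)] in auto)

lemma line_sign_pair:
  "e \<noteq> f \<Longrightarrow>
    line_sign \<Gamma> \<tau> {e, f} = - line_orientation \<Gamma> \<tau> e {e, f} * line_orientation \<Gamma> \<tau> f {e, f}"
  by (simp add: line_sign_def)

lemma simple_graph_line_graph:
  assumes "graph \<Gamma>"
  shows "simple_graph (line_graph \<Gamma>)"
proof -
  have "finite (edges (line_graph \<Gamma>))"
    by (rule finite_subset[of _ "Pow (edges \<Gamma>)"])
      (use assms in \<open>auto simp: line_graph_def graph_def\<close>)
  then show ?thesis
    using assms by (auto simp: simple_graph_def graph_def line_graph_def inj_on_def)
qed

lemma is_oriented_signed_graph_oriented_line_graph:
  assumes "simple_signed_graph (\<Gamma>, s)" and "is_oriented_signed_graph ((\<Gamma>, s), \<tau>)"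
  shows "is_oriented_signed_graph (oriented_line_graph ((\<Gamma>, s), \<tau>))"
proof -
  have G: "graph \<Gamma>" "simple_graph \<Gamma>"
    using assms by auto
  have tau: "\<tau> v e \<in> {1, -1}" if "e \<in> edges \<Gamma>" "v \<in> ends \<Gamma> e" for v e
    using assms that by (fastforce simp: graph_def)
  have lo: "line_orientation \<Gamma> \<tau> e p \<in> {1, -1}" if "p \<in> edges (line_graph \<Gamma>)" "e \<in> p" for e p
  proof -
    from that(1) obtain a b v where ab: "p = {a, b}" "a \<in> edges \<Gamma>" "b \<in> edges \<Gamma>" "a \<noteq> b"
      "v \<in> ends \<Gamma> a" "v \<in> ends \<Gamma> b"
      by (auto simp: line_graph_def)
    then have "common_vertex \<Gamma> p = v"
      using common_vertex_eq[OF G(2)] by blast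
    then show ?thesis
      using ab that(2) tau by (auto simp: line_orientation_def)
  qed
  have pair: "v \<noteq> w" if "{v, w} \<in> edges (line_graph \<Gamma>)" for v w
    using that by (auto simp: line_graph_def doubleton_eq_iff)
  have sg: "line_sign \<Gamma> \<tau> p \<in> {1, -1}" if p: "p \<in> edges (line_graph \<Gamma>)" for p
  proof -
    obtain a b where ab: "p = {a, b}" "a \<noteq> b"
      using p by (auto simp: line_graph_def)
    then show ?thesis
      using lo[OF p, of a] lo[OF p, of b] by (auto simp: line_sign_pair)
  qed
  have e: "ends (line_graph \<Gamma>) p = p" for p
    by (simp add: line_graph_def)
  have out: "line_orientation \<Gamma> \<tau> v p = 0" if "v \<notin> p" for v p
    using that by (simp add: line_orientation_def)
  have "line_orientation \<Gamma> \<tau> v p \<in> {-1, 0, 1} \<and> (line_orientation \<Gamma> \<tau> v p \<noteq> 0 \<longleftrightarrow> v \<in> p)"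
    if "p \<in> edges (line_graph \<Gamma>)" for v p
    using lo[OF that, of v] out[of v p] by (cases "v \<in> p") auto
  moreover have "line_orientation \<Gamma> \<tau> v p * line_orientation \<Gamma> \<tau> w p = - line_sign \<Gamma> \<tau> p"
    if "p \<in> edges (line_graph \<Gamma>)" "p = {v, w}" for v w p
    using pair that by (simp add: line_sign_pair)
  moreover have "is_signed_graph (line_graph \<Gamma>, line_sign \<Gamma> \<tau>)"
    using simple_graph_line_graph[OF G(1)] sg by (simp add: simple_graph_def)
  ultimately show ?thesis
    unfolding oriented_line_graph.simps is_oriented_signed_graph.simps e by blast
qed

end

theory Submission
  imports Defs
begin

text \<open>
  Two distinct edges of a simple graph share at most one vertex. So every entry of either matrix has
  at most one nonzero summand: in the line graph the one from the edge \<open>{e, f}\<close>, in the dual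
  the one from the common vertex, and \<open>\<tau>\<^sub>\<Lambda>\<close> is \<open>\<tau>\<close> at that vertex.
\<close>

text \<open>An edge contributes only if it is incident to both \<open>v\<close> and
  \<open>w\<close>, so every summand off \<open>a\<close> vanishes. The hypergraph is arbitrary
  because the line graph and the dual both use this.\<close>

lemma sum_adj_sign_unique:
  assumes "finite (hedges H)" "a \<in> hedges H" "v \<noteq> w" "(v, a) \<in> incs H" "(w, a) \<in> incs H"
    and "\<And>e. (v, e) \<in> incs H \<Longrightarrow> (w, e) \<in> incs H \<Longrightarrow> e = a"
  shows "(\<Sum>e \<in> hedges H. adj_sign H e v w) = - hsign H v a * hsign H w a"
proof -
  have "(\<Sum>e \<in> hedges H. adj_sign H e v w) = (\<Sum>e \<in> {a}. adj_sign H e v w)"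
    by (rule sum.mono_neutral_right) (use assms(1,2) in \<open>auto simp: adj_sign_def dest: assms(6)\<close>)
  then show ?thesis
    using assms(3-5) by (simp add: adj_sign_def)
qed

text \<open>The disjunct \<open>v = w\<close> covers the diagonal, where incident edges may exist
  but \<open>adj_sign\<close> is 0 by definition.\<close>

lemma sum_adj_sign_eq_0:
  assumes "v = w \<or> (\<forall>e. (v, e) \<notin> incs H \<or> (w, e) \<notin> incs H)"
  shows "(\<Sum>e \<in> hedges H. adj_sign H e v w) = 0"
  by (rule sum.neutral) (use assms in \<open>auto simp: adj_sign_def\<close>)

text \<open>The sums run over different index sets, pairs of edges and vertices, so each is
  evaluated on its own and the values are compared.\<close>

lemma sum_adj_sign_oriented_line_graph:
  fixes \<Gamma> :: "('v, 'e) ugraph" and s :: "'e \<Rightarrow> int" and \<tau> :: "'v \<Rightarrow> 'e \<Rightarrow> int"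
  assumes G: "simple_graph \<Gamma>" and ef: "e \<in> edges \<Gamma>" "f \<in> edges \<Gamma>"
  defines "L \<equiv> hypergraph_of (oriented_line_graph ((\<Gamma>, s), \<tau>))"
    and "D \<equiv> incidence_dual (hypergraph_of ((\<Gamma>, s), \<tau>))"
  shows "(\<Sum>p \<in> hedges L. adj_sign L p e f) = (\<Sum>v \<in> hedges D. adj_sign D v e f)"
proof -
  have incL: "(g, p) \<in> incs L \<longleftrightarrow> g \<in> edges \<Gamma> \<and> p \<in> edges (line_graph \<Gamma>) \<and> g \<in> p" for g p
    by (simp add: L_def line_graph_def)
  have incD: "(g, v) \<in> incs D \<longleftrightarrow> v \<in> verts \<Gamma> \<and> g \<in> edges \<Gamma> \<and> v \<in> ends \<Gamma> g" for g v
    by (simp add: D_def incidence_dual_def)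
  have hedges: "hedges L = edges (line_graph \<Gamma>)" "hedges D = verts \<Gamma>"
    by (simp_all add: L_def D_def incidence_dual_def)
  have hsign: "hsign L = line_orientation \<Gamma> \<tau>" "hsign D = (\<lambda>g v. \<tau> v g)"
    by (simp_all add: L_def D_def incidence_dual_def)
  have graph: "graph \<Gamma>"
    using G by (simp add: simple_graph_def)
  \<comment> \<open>Gives uniqueness of the joining edge when \<open>e\<close> and \<open>f\<close>
    meet, and its absence when they do not.\<close>
  have pairs: "p = {e, f} \<and> ends \<Gamma> e \<inter> ends \<Gamma> f \<noteq> {}"
    if "p \<in> edges (line_graph \<Gamma>)" "e \<in> p" "f \<in> p" "e \<noteq> f" for p
    using that by (auto simp: line_graph_def)
  show ?thesis
  proof (cases "e \<noteq> f \<and> ends \<Gamma> e \<inter> ends \<Gamma> f \<noteq> {}")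
    case True
    then obtain v where v: "v \<in> ends \<Gamma> e" "v \<in> ends \<Gamma> f" and ne: "e \<noteq> f"
      by blast
    have "v \<in> verts \<Gamma>"
      using graph ef v by (auto simp: graph_def)
    have L_edge: "{e, f} \<in> edges (line_graph \<Gamma>)"
      using ef True by (auto simp: line_graph_def)
    have "(\<Sum>p \<in> hedges L. adj_sign L p e f) = - hsign L e {e, f} * hsign L f {e, f}"
    proof (rule sum_adj_sign_unique)
      show "finite (hedges L)"
        using simple_graph_line_graph[OF graph] by (simp add: hedges simple_graph_def graph_def)
      show "p = {e, f}" if "(e, p) \<in> incs L" "(f, p) \<in> incs L" for p
        using that pairs ne unfolding incL by blast
    qed (use ne L_edge ef in \<open>auto simp: hedges incL\<close>)
    \<comment> \<open>The description \<open>common_vertex \<Gamma> {e, f}\<close> evaluates to the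
      chosen \<open>v\<close>.\<close>
    also have "\<dots> = - \<tau> v e * \<tau> v f"
      using common_vertex_eq[OF G ef ne v] by (simp add: hsign line_orientation_def)
    finally have L_sum: "(\<Sum>p \<in> hedges L. adj_sign L p e f) = - \<tau> v e * \<tau> v f" .
    have "(\<Sum>u \<in> hedges D. adj_sign D u e f) = - hsign D e v * hsign D f v"
    proof (rule sum_adj_sign_unique)
      show "finite (hedges D)"
        using graph by (simp add: hedges graph_def)
      \<comment> \<open>Simplicity enters here: two common endpoints would make \<open>e\<close> and
        \<open>f\<close> parallel.\<close>
      show "u = v" if "(e, u) \<in> incs D" "(f, u) \<in> incs D" for u
        using that simple_graph_common_vertex_unique[OF G ef ne] v unfolding incD by blast
    qed (use ne v \<open>v \<in> verts \<Gamma>\<close> ef in \<open>auto simp: hedges incD\<close>)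
    then show ?thesis
      by (simp add: L_sum hsign)
  next
    case False
    have "(\<Sum>p \<in> hedges L. adj_sign L p e f) = 0"
      \<comment> \<open>Either \<open>e = f\<close>, or a line graph edge containing both would
        force a shared endpoint.\<close>
      by (rule sum_adj_sign_eq_0) (use False pairs in \<open>unfold incL, blast\<close>)
    moreover have "(\<Sum>v \<in> hedges D. adj_sign D v e f) = 0"
      by (rule sum_adj_sign_eq_0) (use False in \<open>auto simp: incD\<close>)
    ultimately show ?thesis
      by simp
  qed
qed

theorem theorem3p4:
  fixes \<Gamma> :: "('v, 'e) ugraph" and s :: "'e \<Rightarrow> int" and \<tau> :: "'v \<Rightarrow> 'e \<Rightarrow> int"
    and es :: "'e list"
  assumes "simple_signed_graph (\<Gamma>, s)"
    and "is_oriented_signed_graph ((\<Gamma>, s), \<tau>)"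
    and "distinct es" and "set es = edges \<Gamma>"
  shows "adjacency_matrix (hypergraph_of (oriented_line_graph ((\<Gamma>, s), \<tau>))) es =
         adjacency_matrix (incidence_dual (hypergraph_of ((\<Gamma>, s), \<tau>))) es"
proof -
  have "simple_graph \<Gamma>"
    using assms(1) by simp
  moreover have "es ! i \<in> edges \<Gamma>" if "i < length es" for i
    using assms(4) that nth_mem by auto
  ultimately show ?thesis
    unfolding adjacency_matrix_def
    \<comment> \<open>Both dimensions are \<open>length es\<close>, so only the entries at
      \<open>es ! i\<close> and \<open>es ! j\<close> remain.\<close>
    by (intro cong_mat) (simp_all only: prod.case sum_adj_sign_oriented_line_graph)
qed

end
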